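(* For every non-empty string $w$, $z(w) - 1 + \sigma_w \le g^\ast(w)$, where $z(w)$ is the number of phrases of the LZ-factorization of $w$, $\sigma_w$ is the number of distinct symbols occurring in $w$, and $g^\ast(w)$ is the size of a smallest grammar of $w$.
   Context: A grammar of $w$ is a straight-line program: a context-free grammar in Chomsky normal form with productions $X_i\to\alpha$ ($\alpha$ terminal) or $X_i\to X_jX_k$ ($j,k<i$) deriving exactly $w$; its size is its number of productions. A factorization of $w$ is a sequence $(s_1,\dots,s_m)$ of non-empty strings with $w=s_1\cdots s_m$. Phrase $s_i$ is greedy if either $s_i$ is a single symbol occurring for the first time in $s_1\cdots s_i$, or $s_i$ is the longest prefix of $s_i\cdots s_m$ that occurs as a substring of $s_1\cdots s_{i-1}$. The LZ-factorization of $w$ is the factorization in which all phrases are greedy; $z(w)$ is its number of phrases. *)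

theory Defs
  imports Main "HOL-Library.Sublist"
begin

section \<open>Straight-line programs\<close>

text \<open>
  A straight-line program is a list \<open>G\<close> of productions: \<open>G ! i\<close> is the right-hand side of the
  only production of the nonterminal \<open>X\<^sub>i\<close> (counting from 0). The start symbol is the last
  nonterminal.
\<close>

datatype 'a rhs = Term 'a | Cat nat nat

type_synonym 'a slp = "'a rhs list"

definition wf_slp :: "'a slp \<Rightarrow> bool" where
  "wf_slp G \<longleftrightarrow> (\<forall>i < length G. \<forall>j k. G ! i = Cat j k \<longrightarrow> j < i \<and> k < i)"

inductive derives :: "'a slp \<Rightarrow> nat \<Rightarrow> 'a list \<Rightarrow> bool" for G :: "'a slp" where
  derives_Term: "\<lbrakk>i < length G; G ! i = Term a\<rbrakk> \<Longrightarrow> derives G i [a]"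
| derives_Cat: "\<lbrakk>i < length G; G ! i = Cat j k; derives G j u; derives G k v\<rbrakk>
    \<Longrightarrow> derives G i (u @ v)"

definition slp_lang :: "'a slp \<Rightarrow> 'a list set" where
  "slp_lang G = {w. derives G (length G - 1) w}"

definition grammar_of :: "'a slp \<Rightarrow> 'a list \<Rightarrow> bool" where
  "grammar_of G w \<longleftrightarrow> wf_slp G \<and> slp_lang G = {w}"

definition min_grammar_size :: "'a list \<Rightarrow> nat" where
  "min_grammar_size w = (LEAST n. \<exists>G. grammar_of G w \<and> length G = n)"

lemma derives_append: "derives G i w \<Longrightarrow> derives (G @ H) i w"
  by (induction rule: derives.induct)
    (auto intro: derives_Term derives_Cat simp: nth_append)

lemma derives_unique: "derives G i u \<Longrightarrow> derives G i v \<Longrightarrow> u = v"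
proof (induction arbitrary: v rule: derives.induct)
  case (derives_Term i a)
  from derives_Term(3,1,2) show ?case by cases auto
next
  case (derives_Cat i j k u1 u2)
  from derives_Cat.prems show ?case
  proof cases
    case (derives_Cat j' k' v1 v2)
    with derives_Cat.hyps(2) have "j' = j" "k' = k" by auto
    with derives_Cat derives_Cat.IH show ?thesis by blast
  qed (use derives_Cat.hyps(2) in simp)
qed

lemma grammar_of_iff: "grammar_of G w \<longleftrightarrow> wf_slp G \<and> derives G (length G - 1) w"
  unfolding grammar_of_def slp_lang_def by (auto dest: derives_unique)

lemma ex_grammar_of: "w \<noteq> [] \<Longrightarrow> \<exists>G. grammar_of G w"
proof (induction w rule: rev_nonempty_induct)
  case (single a)
  have "grammar_of [Term a] [a]"
    by (auto simp: grammar_of_iff wf_slp_def intro: derives_Term)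
  then show ?case ..
next
  case (snoc a w)
  then obtain G where G: "wf_slp G" "derives G (length G - 1) w"
    by (auto simp: grammar_of_iff)
  from G(2) have ne: "G \<noteq> []" by cases auto
  let ?n = "length G"
  let ?H = "G @ [Term a, Cat (?n - 1) ?n]"
  have "derives ?H (?n - 1) w"
    using G(2) by (rule derives_append)
  moreover have "derives ?H ?n [a]"
    by (rule derives_Term) simp_all
  ultimately have "derives ?H (Suc ?n) (w @ [a])"
    by (intro derives_Cat[where j = "?n - 1" and k = ?n]) (simp_all add: nth_append)
  moreover have "wf_slp ?H"
    using G(1) ne by (auto simp: wf_slp_def nth_append nth_Cons split: if_splits nat.splits)
  ultimately have "grammar_of ?H (w @ [a])"
    by (simp add: grammar_of_iff)
  then show ?case ..
qed

section \<open>The LZ-factorization\<close>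

definition factorization :: "'a list \<Rightarrow> 'a list list \<Rightarrow> bool" where
  "factorization w ss \<longleftrightarrow> concat ss = w \<and> [] \<notin> set ss"

text \<open>
  In \<open>greedy u s v\<close>, the string \<open>u\<close> is the part of the text before the phrase \<open>s\<close>,
  and \<open>v\<close> is the remaining text, starting with \<open>s\<close>. An earlier occurrence of a phrase must lie
  within \<open>u\<close>, so it may not overlap the phrase.
\<close>

definition greedy :: "'a list \<Rightarrow> 'a list \<Rightarrow> 'a list \<Rightarrow> bool" where
  "greedy u s v \<longleftrightarrow>
     (\<exists>a. s = [a] \<and> a \<notin> set u) \<or>
     (prefix s v \<and> sublist s u \<and> (\<forall>t. prefix t v \<and> sublist t u \<longrightarrow> length t \<le> length s))"

definition lz_factorization :: "'a list \<Rightarrow> 'a list list \<Rightarrow> bool" where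
  "lz_factorization w ss \<longleftrightarrow> factorization w ss \<and>
     (\<forall>i < length ss. greedy (concat (take i ss)) (ss ! i) (concat (drop i ss)))"

definition lz_size :: "'a list \<Rightarrow> nat" where
  "lz_size w = length (THE ss. lz_factorization w ss)"

lemma greedy_unique:
  assumes "greedy u s v" "greedy u t v" "prefix s v" "prefix t v" "s \<noteq> []" "t \<noteq> []"
  shows "s = t"
proof -
  have new: "x = [a]" if "a \<notin> set u" "greedy u x v" "prefix [a] v" "prefix x v" "x \<noteq> []" for a x
  proof -
    from that(3-5) obtain y where x: "x = a # y" by (cases x) (auto simp: prefix_def)
    with that(1) have "\<not> sublist x u" by (auto dest: set_mono_sublist)
    with that(2) x show ?thesis by (auto simp: greedy_def)
  qed
  show ?thesis
  proof (cases "(\<exists>a. s = [a] \<and> a \<notin> set u) \<or> (\<exists>a. t = [a] \<and> a \<notin> set u)")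
    case True
    then show ?thesis
    proof (elim disjE exE conjE)
      fix a assume "s = [a]" "a \<notin> set u"
      with new[of a t] assms show ?thesis by simp
    next
      fix a assume "t = [a]" "a \<notin> set u"
      with new[of a s] assms show ?thesis by simp
    qed
  next
    case False
    with assms(1,2) have "length s = length t"
      unfolding greedy_def by (meson le_antisym)
    with assms(3,4) show ?thesis
      by (auto simp: prefix_def)
  qed
qed

lemma ex_greedy:
  assumes "v \<noteq> []"
  shows "\<exists>s. s \<noteq> [] \<and> prefix s v \<and> greedy u s v"
proof -
  from assms obtain a v' where v: "v = a # v'" by (cases v) auto
  show ?thesis
  proof (cases "a \<in> set u")
    case False
    then show ?thesis by (intro exI[of _ "[a]"]) (auto simp: v greedy_def)
  next
    case True
    let ?P = "\<lambda>t. prefix t v \<and> sublist t u"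
    have a: "?P [a]" using True by (auto simp: v sublist_def in_set_conv_decomp)
    have "\<forall>t. ?P t \<longrightarrow> length t < Suc (length v)"
      by (auto dest: prefix_length_le)
    from ex_has_greatest_nat[of ?P, OF a this]
    obtain s where s: "?P s" "\<forall>t. ?P t \<longrightarrow> length t \<le> length s" by blast
    with a have "length [a] \<le> length s" by blast
    then have "s \<noteq> []" by auto
    with s show ?thesis by (auto simp: greedy_def)
  qed
qed

lemma lz_exists_aux:
  "\<exists>ss. factorization v ss \<and>
     (\<forall>i < length ss. greedy (u @ concat (take i ss)) (ss ! i) (concat (drop i ss)))"
proof (induction v arbitrary: u rule: length_induct)
  case (1 v)
  show ?case
  proof (cases "v = []")
    case True
    then show ?thesis by (intro exI[of _ "[]"]) (auto simp: factorization_def)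
  next
    case False
    from ex_greedy[OF this, of u] obtain s v' where s: "s \<noteq> []" "v = s @ v'" "greedy u s v"
      by (auto simp: prefix_def)
    then have "length v' < length v" by simp
    with 1[rule_format, of v' "u @ s"] obtain ss where "factorization v' ss"
      "\<forall>i < length ss. greedy ((u @ s) @ concat (take i ss)) (ss ! i) (concat (drop i ss))"
      by blast
    with s show ?thesis
      by (intro exI[of _ "s # ss"]) (auto simp: factorization_def less_Suc_eq_0_disj)
  qed
qed

lemma lz_unique_aux:
  assumes "concat ss = concat tt" "[] \<notin> set ss" "[] \<notin> set tt"
    "\<forall>i < length ss. greedy (u @ concat (take i ss)) (ss ! i) (concat (drop i ss))"
    "\<forall>i < length tt. greedy (u @ concat (take i tt)) (tt ! i) (concat (drop i tt))"
  shows "ss = tt"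
  using assms
proof (induction ss arbitrary: tt u)
  case Nil
  then show ?case by (cases tt) auto
next
  case (Cons s ss)
  then obtain t tt' where tt: "tt = t # tt'" by (cases tt) auto
  have g: "greedy u s (concat (s # ss))" "greedy u t (concat (s # ss))"
    using Cons.prems(4)[rule_format, of 0] Cons.prems(5)[rule_format, of 0] Cons.prems(1)
    by (auto simp: tt)
  have "prefix t (concat (s # ss))"
    unfolding Cons.prems(1) by (simp add: tt)
  with Cons.prems(2,3) have st: "s = t"
    by (intro greedy_unique[OF g]) (auto simp: tt)
  have "ss = tt'"
  proof (rule Cons.IH[of _ "u @ s"])
    show "concat ss = concat tt'" "[] \<notin> set ss" "[] \<notin> set tt'"
      using Cons.prems(1-3) by (auto simp: tt st)
    show "\<forall>i<length ss. greedy ((u @ s) @ concat (take i ss)) (ss ! i) (concat (drop i ss))"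
    proof (intro allI impI)
      fix i assume "i < length ss"
      with Cons.prems(4)[rule_format, of "Suc i"]
      show "greedy ((u @ s) @ concat (take i ss)) (ss ! i) (concat (drop i ss))" by simp
    qed
    show "\<forall>i<length tt'. greedy ((u @ s) @ concat (take i tt')) (tt' ! i) (concat (drop i tt'))"
    proof (intro allI impI)
      fix i assume "i < length tt'"
      with Cons.prems(5)[rule_format, of "Suc i"]
      show "greedy ((u @ s) @ concat (take i tt')) (tt' ! i) (concat (drop i tt'))"
        by (simp add: tt st)
    qed
  qed
  with st tt show ?case by simp
qed

lemma ex1_lz_factorization: "\<exists>!ss. lz_factorization w ss"
proof (rule ex_ex1I)
  show "\<exists>ss. lz_factorization w ss"
    using lz_exists_aux[of w "[]"] by (simp add: lz_factorization_def)
  show "ss = tt" if "lz_factorization w ss" "lz_factorization w tt" for ss tt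
    using that lz_unique_aux[of ss tt "[]"] by (simp add: lz_factorization_def factorization_def)
qed

end

theory Submission
  imports Defs
begin

text \<open>
  In the parse tree of a smallest grammar, expand every nonterminal only at its leftmost
  occurrence. The expanded inner nodes then correspond to distinct binary productions, so the
  pruned tree has at most one leaf more than there are binary productions. Each leaf is a single
  symbol or a string that occurred before, and no factorization with this property has fewer
  phrases than the greedy one. Besides its binary productions the grammar needs one terminal
  production for each symbol of \<open>w\<close>.
\<close>

section \<open>Optimality of the LZ-factorization\<close>

fun copying :: "'a list \<Rightarrow> 'a list list \<Rightarrow> bool" where
  "copying u [] \<longleftrightarrow> True"
| "copying u (s # ss) \<longleftrightarrow> (length s = 1 \<or> sublist s u) \<and> copying (u @ s) ss"

lemma copying_append:
  "copying u (ss @ tt) \<longleftrightarrow> copying u ss \<and> copying (u @ concat ss) tt"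
  by (induction ss arbitrary: u) auto

text \<open>If \<open>s\<close> is a symbol absent from \<open>u\<close>, a \<open>y\<close> of
  length at least 2 would start with that symbol and so could not occur in \<open>u\<close>.
  Otherwise the maximality of \<open>s\<close> applies.\<close>

lemma greedy_length_ge:
  assumes "greedy u s v" "prefix s v" "s \<noteq> []" "prefix y v" "length y = 1 \<or> sublist y u"
  shows "length y \<le> length s"
proof (cases "length y \<le> 1")
  case True
  with assms(3) show ?thesis by (cases s) auto
next
  case False
  with assms(5) have y: "sublist y u" by auto
  from assms(1) show ?thesis
    unfolding greedy_def
  proof (elim disjE exE conjE)
    fix a assume a: "s = [a]" "a \<notin> set u"
    from False obtain b y' where b: "y = b # y'" by (cases y) auto
    with assms(2,4) a have "b = a" by (auto simp: prefix_def)
    with a b y have False by (auto dest: set_mono_sublist)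
    then show ?thesis ..
  next
    assume "\<forall>t. prefix t v \<and> sublist t u \<longrightarrow> length t \<le> length s"
    with assms(4) y show ?thesis by blast
  qed
qed

text \<open>
  Here \<open>x\<close> is the text by which the greedy factorization \<open>ss\<close> is ahead of the competitor \<open>tt\<close>.
\<close>

lemma greedy_optimal:
  assumes "copying u tt" "concat tt = x @ concat ss" "[] \<notin> set ss"
    "\<forall>i < length ss. greedy (u @ x @ concat (take i ss)) (ss ! i) (concat (drop i ss))"
  shows "length ss \<le> length tt"
  using assms
proof (induction tt arbitrary: u x ss)
  case Nil
  then show ?case by (cases ss) auto
next
  case (Cons t tt)
  show ?case
  proof (cases "length t \<le> length x")
    case True
    \<comment> \<open>\<open>t\<close> lies inside the lead: the lead shrinks to \<open>x'\<close>,
      and no greedy phrase is consumed.\<close>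
    with Cons.prems(2) obtain x' where x: "x = t @ x'"
      by (auto simp: append_eq_append_conv2)
    have "length ss \<le> length tt"
      by (rule Cons.IH[of "u @ t" x']) (use Cons.prems x in auto)
    then show ?thesis by simp
  next
    case False
    with Cons.prems(2) obtain y where t: "t = x @ y" "concat ss = y @ concat tt" "y \<noteq> []"
      by (auto simp: append_eq_append_conv2)
    then obtain s ss' where ss: "ss = s # ss'" by (cases ss) auto
    have g: "greedy (u @ x) s (concat ss)"
      using Cons.prems(4)[rule_format, of 0] by (simp add: ss)
    \<comment> \<open>\<open>y\<close> is the part of \<open>t\<close> beyond the lead. As a suffix
      of \<open>t\<close> it is again a single symbol or an earlier string, so \<open>s\<close>,
      which starts at the same place, reaches at least as far as \<open>t\<close>.\<close>
    have y: "length y = 1 \<or> sublist y (u @ x)"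
    proof (cases "length t = 1")
      case True
      with t(1,3) show ?thesis by (cases y) auto
    next
      case False
      with Cons.prems(1) have "sublist t u" by simp
      with t(1) show ?thesis
        using sublist_order.order_trans[of y t u] by (simp add: sublist_append)
    qed
    have "length y \<le> length s"
      proof (rule greedy_length_ge[OF g _ _ _ y])
      show "prefix s (concat ss)" by (simp add: ss)
      show "s \<noteq> []" using Cons.prems(3) by (auto simp: ss)
      show "prefix y (concat ss)" by (simp add: t(2))
    qed
    with t(2) obtain x' where s: "s = y @ x'" "concat tt = x' @ concat ss'"
      by (auto simp: ss append_eq_append_conv2)
    have "length ss' \<le> length tt"
    proof (rule Cons.IH[of "u @ t" x'])
      show "\<forall>i<length ss'. greedy ((u @ t) @ x' @ concat (take i ss')) (ss' ! i) (concat (drop i ss'))"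
      proof (intro allI impI)
        fix i assume "i < length ss'"
        with Cons.prems(4)[rule_format, of "Suc i"]
        show "greedy ((u @ t) @ x' @ concat (take i ss')) (ss' ! i) (concat (drop i ss'))"
          by (simp add: ss s t)
      qed
    qed (use Cons.prems ss s in auto)
    then show ?thesis by (simp add: ss)
  qed
qed

lemma lz_size_le:
  assumes "copying [] tt"
  shows "lz_size (concat tt) \<le> length tt"
proof -
  have "lz_factorization (concat tt) (THE ss. lz_factorization (concat tt) ss)"
    by (rule theI'[OF ex1_lz_factorization])
  then show ?thesis
    using greedy_optimal[of "[]" tt "[]"] assms
    by (auto simp: lz_size_def lz_factorization_def factorization_def)
qed

section \<open>Pruning the parse tree\<close>

definition cats :: "'a slp \<Rightarrow> nat set" where
  "cats G = {i. i < length G \<and> (\<exists>j k. G ! i = Cat j k)}"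

lemma finite_cats [simp]: "finite (cats G)"
  by (simp add: cats_def)

text \<open>
  The set \<open>S\<close> collects the nonterminals that have been expanded before, and \<open>S'\<close> those expanded
  after processing \<open>X\<^sub>i\<close>. The bound \<open>S' \<subseteq> S \<union> {..i}\<close> guarantees that \<open>X\<^sub>i\<close> does not count among the
  nonterminals expanded below it.
\<close>

lemma derives_copying:
  assumes "derives G i w" "wf_slp G" "\<forall>n\<in>S. \<forall>x. derives G n x \<longrightarrow> sublist x u"
  shows "\<exists>tt S'. copying u tt \<and> concat tt = w \<and> S \<subseteq> S' \<and> S' \<subseteq> S \<union> {..i} \<and>
    (\<forall>n\<in>S'. \<forall>x. derives G n x \<longrightarrow> sublist x (u @ w)) \<and>
    length tt + card (S \<inter> cats G) \<le> 1 + card (S' \<inter> cats G)"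
  using assms
proof (induction arbitrary: u S rule: derives.induct)
  case (derives_Term i a)
  have "\<forall>n\<in>S. \<forall>x. derives G n x \<longrightarrow> sublist x (u @ [a])"
    using derives_Term.prems(2) by (simp add: sublist_append)
  then show ?case
    by (intro exI[of _ "[[a]]"] exI[of _ S]) simp
next
  case (derives_Cat i j k v1 v2)
  have D: "derives G i (v1 @ v2)"
    using derives_Cat.hyps by (rule derives.derives_Cat)
  show ?case
  proof (cases "i \<in> S")
    case True
    then have "copying u [v1 @ v2]"
      using derives_Cat.prems(2) D by simp
    moreover have "\<forall>n\<in>S. \<forall>x. derives G n x \<longrightarrow> sublist x (u @ v1 @ v2)"
      using derives_Cat.prems(2) by (simp add: sublist_append[of _ u])
    ultimately show ?thesis
      by (intro exI[of _ "[v1 @ v2]"] exI[of _ S]) simp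
  next
    case False
    have less: "j < i" "k < i"
      using derives_Cat.prems(1) derives_Cat.hyps(1,2) by (auto simp: wf_slp_def)
    obtain tt1 S1 where 1: "copying u tt1" "concat tt1 = v1" "S \<subseteq> S1" "S1 \<subseteq> S \<union> {..j}"
      "\<forall>n\<in>S1. \<forall>x. derives G n x \<longrightarrow> sublist x (u @ v1)"
      "length tt1 + card (S \<inter> cats G) \<le> 1 + card (S1 \<inter> cats G)"
      using derives_Cat.IH(1)[of S u, OF derives_Cat.prems] by (elim exE conjE) (rule that)
    obtain tt2 S2 where 2: "copying (u @ v1) tt2" "concat tt2 = v2" "S1 \<subseteq> S2" "S2 \<subseteq> S1 \<union> {..k}"
      "\<forall>n\<in>S2. \<forall>x. derives G n x \<longrightarrow> sublist x ((u @ v1) @ v2)"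
      "length tt2 + card (S1 \<inter> cats G) \<le> 1 + card (S2 \<inter> cats G)"
      using derives_Cat.IH(2)[of S1 "u @ v1", OF derives_Cat.prems(1) 1(5)]
      by (elim exE conjE) (rule that)
    have S2: "S2 \<subseteq> S \<union> {..<i}"
    proof
      fix n assume "n \<in> S2"
      with 2(4) have "n \<in> S1 \<or> n \<le> k" by (auto dest: subsetD)
      with 1(4) have "n \<in> S \<or> n \<le> j \<or> n \<le> k" by (auto dest: subsetD)
      with less show "n \<in> S \<union> {..<i}" by auto
    qed
    with False have "i \<notin> S2" by auto
    moreover have "i \<in> cats G" using derives_Cat.hyps by (auto simp: cats_def)
    \<comment> \<open>Each of the two subtrees brings an allowance of 1; counting the new
      \<open>i\<close> absorbs one of them.\<close>
    ultimately have c: "card (insert i S2 \<inter> cats G) = Suc (card (S2 \<inter> cats G))" by simp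
    show ?thesis
    proof (rule exI[of _ "tt1 @ tt2"], rule exI[of _ "insert i S2"], intro conjI ballI allI impI)
      show "sublist x (u @ v1 @ v2)" if "n \<in> insert i S2" "derives G n x" for n x
      proof (cases "n = i")
        case True
        with that(2) derives_unique[OF D] have "x = v1 @ v2" by blast
        then show ?thesis by simp
      next
        case False
        with that 2(5) show ?thesis by simp
      qed
      have "{..<i} \<subseteq> {..i}" by auto
      with S2 show "insert i S2 \<subseteq> S \<union> {..i}" by auto
      show "copying u (tt1 @ tt2)" using 1(1,2) 2(1) by (simp add: copying_append)
      show "concat (tt1 @ tt2) = v1 @ v2" using 1(2) 2(2) by simp
      show "S \<subseteq> insert i S2" using 1(3) 2(3) by blast
      show "length (tt1 @ tt2) + card (S \<inter> cats G) \<le> 1 + card (insert i S2 \<inter> cats G)"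
        using 1(6) 2(6) c by simp
    qed
  qed
qed

lemma derives_Term_in_set: "derives G i w \<Longrightarrow> a \<in> set w \<Longrightarrow> Term a \<in> set G"
  by (induction rule: derives.induct) (auto simp: in_set_conv_nth)

lemma cats_terms_le:
  assumes "derives G i w"
  shows "card (cats G) + card (set w) \<le> length G"
proof -
  let ?T = "{..<length G} - cats G"
  have sub: "cats G \<subseteq> {..<length G}" by (auto simp: cats_def)
  \<comment> \<open>Each symbol of \<open>w\<close> is hit by the index of its terminal production.
    The missing \<open>Cat\<close> branch is harmless, as \<open>?T\<close> excludes
    \<open>cats G\<close>.\<close>
  have "a \<in> (\<lambda>n. case G ! n of Term b \<Rightarrow> b) ` ?T" if "a \<in> set w" for a
  proof -
    from derives_Term_in_set[OF assms that] obtain n where "n < length G" "G ! n = Term a"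
      by (auto simp: in_set_conv_nth)
    then show ?thesis by (intro image_eqI[of _ _ n]) (auto simp: cats_def)
  qed
  then have "card (set w) \<le> card ?T"
    by (intro surj_card_le) auto
  also have "card ?T = length G - card (cats G)"
    using sub by (subst card_Diff_subset) auto
  finally show ?thesis
    using card_mono[OF _ sub] by simp
qed

lemma grammar_size_ge:
  assumes "grammar_of G w"
  shows "lz_size w + card (set w) \<le> 1 + length G"
proof -
  from assms have G: "wf_slp G" "derives G (length G - 1) w"
    by (auto simp: grammar_of_iff)
  \<comment> \<open>With nothing expanded yet, the condition on \<open>S\<close> is vacuous and its
    count is 0; the remaining allowance of 1 is the \<open>- 1\<close> of the final bound.\<close>
  from derives_copying[OF G(2,1), of "{}" "[]"] obtain tt S where
    "copying [] tt" "concat tt = w" "length tt \<le> 1 + card (S \<inter> cats G)"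
    by auto
  moreover have "card (S \<inter> cats G) \<le> card (cats G)"
    by (intro card_mono) auto
  ultimately have "lz_size w \<le> 1 + card (cats G)"
    using lz_size_le[of tt] by simp
  with cats_terms_le[OF G(2)] show ?thesis by simp
qed

theorem theorem1:
  fixes w :: "'a list"
  assumes "w \<noteq> []"
  shows "int (lz_size w) - 1 + int (card (set w)) \<le> int (min_grammar_size w)"
proof -
  from ex_grammar_of[OF assms] have "\<exists>n G. grammar_of G w \<and> length G = n" by blast
  then have "\<exists>G. grammar_of G w \<and> length G = min_grammar_size w"
    unfolding min_grammar_size_def by (rule LeastI_ex)
  then obtain G where "grammar_of G w" "length G = min_grammar_size w" by blast
  with grammar_size_ge[of G w] show ?thesis by linarith
qed

end
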